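(* Consider the hereditary maximin share problem with $n\ge 1$ agents and a hereditary set system $H=(J,\mathcal{F})$ on a finite set $J$ of $m$ items, as described in the context, and assume ${\tt MMS}(i)>0$ for every agent $i$. Run the Fair Division Procedure (described in the context) with target value $\alpha=\frac{11}{30}$. Then, for every choice of the maximin partitions used in the normalization and for every choice of the pairs $(S,i)$ made during the procedure, every agent $i$ is allocated a bundle $S_i$, and $v_i(S_i)\ge \frac{11}{30}\cdot {\tt MMS}(i)$.
   Context: A hereditary set system $H=(J,\mathcal{F})$ consists of a finite set $J$ of items and a nonempty family $\mathcal{F}$ of subsets of $J$ (the feasible or independent sets) such that $S\in\mathcal{F}$ and $T\subseteq S$ imply $T\in\mathcal{F}$. There is a set $I$ of $n$ agents; agent $i$ has a nonnegative value $v_{i,j}$ for each item $j$, and for any $S\subseteq J$ its value is $v_i(S)=\max_{T\in\mathcal{F},\,T\subseteq S}\sum_{j\in T}v_{i,j}$. Let $\mathbb{P}$ be the set of partitions of $J$ into $n$ (possibly empty) parts. The maximin share of agent $i$ is ${\tt MMS}(i)=\max_{\mathcal{P}\in\mathbb{P}}\min_{P\in\mathcal{P}}v_i(P)$, and a partition attaining it is a maximin partition for $i$. Fair Division Procedure with target $\alpha$: (1) Normalization: for each agent $i$ fix a maximin partition $\mathcal{P}_i$; for an item $j$ lying in part $P\in\mathcal{P}_i$ set $\hat v_{i,j}=v_{i,j}/v_i(P)$, and define $\hat v_i(S)=\max_{T\in\mathcal{F},T\subseteq S}\sum_{j\in T}\hat v_{i,j}$. (2) Let $I$ be the set of all agents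 and $J$ the set of all items. For $\tau=1,2,\dots,m$: while there exist a set $S\subseteq J$ with $|S|=\tau$ and an agent $i\in I$ with $\hat v_i(S)\ge\alpha$, choose any such pair, allocate bundle $S$ to agent $i$, and set $I\leftarrow I\setminus\{i\}$, $J\leftarrow J\setminus S$. *)

theory Defs
  imports Complex_Main "HOL-Library.Disjoint_Sets"
begin

definition hereditary_system :: "'b set \<Rightarrow> 'b set set \<Rightarrow> bool" where
  "hereditary_system J F \<longleftrightarrow>
     finite J \<and> F \<subseteq> Pow J \<and> F \<noteq> {} \<and> (\<forall>S\<in>F. \<forall>T. T \<subseteq> S \<longrightarrow> T \<in> F)"

definition bundle_value :: "'b set set \<Rightarrow> ('b \<Rightarrow> real) \<Rightarrow> 'b set \<Rightarrow> real" where
  "bundle_value F u S = Max {\<Sum>j\<in>T. u j |T. T \<in> F \<and> T \<subseteq> S}"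

text \<open>The parts are indexed by \<open>{..<n}\<close>, so that several of them may be empty;
  \<open>Q k\<close> is irrelevant for \<open>k \<ge> n\<close>.\<close>

definition is_partition :: "nat \<Rightarrow> 'b set \<Rightarrow> (nat \<Rightarrow> 'b set) \<Rightarrow> bool" where
  "is_partition n J Q \<longleftrightarrow> disjoint_family_on Q {..<n} \<and> (\<Union>k<n. Q k) = J"

definition min_part_value :: "nat \<Rightarrow> 'b set set \<Rightarrow> ('b \<Rightarrow> real) \<Rightarrow> (nat \<Rightarrow> 'b set) \<Rightarrow> real" where
  "min_part_value n F u Q = Min ((\<lambda>k. bundle_value F u (Q k)) ` {..<n})"

definition MMS :: "nat \<Rightarrow> 'b set \<Rightarrow> 'b set set \<Rightarrow> ('b \<Rightarrow> real) \<Rightarrow> real" where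
  "MMS n J F u = Max {min_part_value n F u Q |Q. is_partition n J Q}"

definition maximin_partition ::
  "nat \<Rightarrow> 'b set \<Rightarrow> 'b set set \<Rightarrow> ('b \<Rightarrow> real) \<Rightarrow> (nat \<Rightarrow> 'b set) \<Rightarrow> bool" where
  "maximin_partition n J F u Q \<longleftrightarrow>
     is_partition n J Q \<and> min_part_value n F u Q = MMS n J F u"

definition normalized ::
  "nat \<Rightarrow> 'b set set \<Rightarrow> ('b \<Rightarrow> real) \<Rightarrow> (nat \<Rightarrow> 'b set) \<Rightarrow> 'b \<Rightarrow> real" where
  "normalized n F u Q j = u j / bundle_value F u (Q (THE k. k < n \<and> j \<in> Q k))"

text \<open>A state \<open>(\<tau>, I, J, A)\<close> consists of the current bundle size, the agents and items still
  present, and the bundles allocated so far. The argument \<open>m\<close> is the initial number of items and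
  \<open>w i\<close> are the normalized item values of agent \<open>i\<close>. The procedure halts when \<open>\<tau> = Suc m\<close>.\<close>

type_synonym ('a, 'b) fdp_state = "nat \<times> 'a set \<times> 'b set \<times> ('a \<rightharpoonup> 'b set)"

definition valid_pair ::
  "real \<Rightarrow> 'b set set \<Rightarrow> ('a \<Rightarrow> 'b \<Rightarrow> real) \<Rightarrow> nat \<Rightarrow> 'a set \<Rightarrow> 'b set \<Rightarrow> 'b set \<Rightarrow> 'a \<Rightarrow> bool" where
  "valid_pair \<alpha> F w \<tau> I J S i \<longleftrightarrow>
     S \<subseteq> J \<and> card S = \<tau> \<and> i \<in> I \<and> bundle_value F (w i) S \<ge> \<alpha>"

inductive fdp_step ::
  "real \<Rightarrow> 'b set set \<Rightarrow> ('a \<Rightarrow> 'b \<Rightarrow> real) \<Rightarrow> nat \<Rightarrow> ('a, 'b) fdp_state \<Rightarrow> ('a, 'b) fdp_state \<Rightarrow> bool"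
  for \<alpha> :: real and F :: "'b set set" and w :: "'a \<Rightarrow> 'b \<Rightarrow> real" and m :: nat where
  allocate: "\<tau> \<le> m \<Longrightarrow> valid_pair \<alpha> F w \<tau> I J S i \<Longrightarrow>
     fdp_step \<alpha> F w m (\<tau>, I, J, A) (\<tau>, I - {i}, J - S, A(i \<mapsto> S))"
| advance: "\<tau> \<le> m \<Longrightarrow> \<nexists>S i. valid_pair \<alpha> F w \<tau> I J S i \<Longrightarrow>
     fdp_step \<alpha> F w m (\<tau>, I, J, A) (Suc \<tau>, I, J, A)"

text \<open>\<open>A\<close> is a possible final allocation of a complete run with target \<open>\<alpha>\<close>, where \<open>P i\<close> is the
  partition used to normalize the values of agent \<open>i\<close>; \<open>A i = None\<close> means that \<open>i\<close> receives
  no bundle.\<close>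

definition fdp_result ::
  "real \<Rightarrow> 'a set \<Rightarrow> 'b set \<Rightarrow> 'b set set \<Rightarrow> ('a \<Rightarrow> 'b \<Rightarrow> real) \<Rightarrow>
   ('a \<Rightarrow> nat \<Rightarrow> 'b set) \<Rightarrow> ('a \<rightharpoonup> 'b set) \<Rightarrow> bool" where
  "fdp_result \<alpha> I J F v P A \<longleftrightarrow>
     (\<exists>I' J'. (fdp_step \<alpha> F (\<lambda>i. normalized (card I) F (v i) (P i)) (card J))\<^sup>*\<^sup>*
        (1, I, J, Map.empty) (Suc (card J), I', J', A))"

text \<open>Sanity check: every run of the procedure terminates, and it can only stop when
  \<open>\<tau> = Suc m\<close>; hence \<^const>\<open>fdp_result\<close> covers the outcomes of all runs.\<close>

lemma fdp_progress:
  assumes "\<tau> \<le> m"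
  shows "\<exists>s. fdp_step \<alpha> F w m (\<tau>, I, J, A) s"
  using assms by (cases "\<exists>S i. valid_pair \<alpha> F w \<tau> I J S i") (blast intro: fdp_step.intros)+

lemma fdp_terminates:
  assumes "finite I"
  shows "Wellfounded.accp (fdp_step \<alpha> F w m)\<inverse>\<inverse> (\<tau>, I, J, A)"
  using assms
proof (induction "(Suc m - \<tau>) + card I" arbitrary: \<tau> I J A rule: less_induct)
  case less
  show ?case
  proof (rule accp.accI)
    fix s assume "(fdp_step \<alpha> F w m)\<inverse>\<inverse> s (\<tau>, I, J, A)"
    then have "fdp_step \<alpha> F w m (\<tau>, I, J, A) s" by simp
    then show "Wellfounded.accp (fdp_step \<alpha> F w m)\<inverse>\<inverse> s"
    proof cases
      case (allocate S i)
      then have "card (I - {i}) < card I"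
        using less.prems by (intro card_Diff1_less) (auto simp: valid_pair_def)
      then show ?thesis using allocate less by simp
    next
      case advance
      then show ?thesis using less by simp
    qed
  qed
qed

lemma fdp_step_bound:
  assumes "fdp_step \<alpha> F w m (\<tau>, I, J, A) (\<tau>', I', J', A')"
  shows "\<tau>' \<le> Suc m"
  using assms by cases auto

end

theory Submission
  imports Defs
begin

text \<open>
  A bundle is allocated only when no smaller bundle is acceptable to any remaining agent. Hence it
  is feasible, and an agent \<open>i\<close> that is still waiting values all its proper subsets below
  \<open>11/30\<close>. If \<open>i\<close> is never served, put a charge on the allocated items: \<open>1\<close> on the item of a
  singleton, \<open>1/2\<close> on both items of a pair, and \<open>w j / w(S)\<close> on an item \<open>j\<close> of a larger
  bundle \<open>S\<close>, where \<open>w\<close> is the normalized value of \<open>i\<close>. Every bundle carries a charge of at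
  most \<open>1\<close>. On the other hand, each of the \<open>n\<close> parts in the partition of \<open>i\<close> has lost all of its
  value \<open>1\<close> except for less than \<open>11/30\<close>, and this forces a charge of at least \<open>1\<close> on the part. So
  there are \<open>n\<close> bundles, although at most \<open>n - 1\<close> agents have been served. The critical case is a
  part that loses one item to a pair and a value above \<open>8/30\<close> to larger bundles. There the bounds
  \<open>w(S) \<le> 11/30 + w j\<close> and \<open>w(S) \<le> 22/30 - w j\<close> yield the missing charge \<open>1/2\<close>.
\<close>

section \<open>Estimates for the charge of items in bundles of size at least three\<close>

text \<open>Here \<open>y\<close> is an item's value and \<open>t\<close> its bundle's total, so
  \<open>y / t\<close> is the charge. The first bound serves parts that lose nothing to pairs, the
  other two serve parts with one pair item. If \<open>t = 0\<close>, then \<open>y = 0\<close> and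
  the quotient is 0 by convention.\<close>

lemma item_charge_bounds:
  fixes y t :: real
  assumes "0 \<le> y" "y \<le> t" "t \<le> 11/30 + y" "t \<le> 22/30 - y"
  shows "20/11 * y \<le> y / t"
    and "2 * min y (2/15) \<le> y / t"
    and "2 * y - 1/30 \<le> y / t"
proof -
  have le_div: "k \<le> y / t" if "k * t \<le> y" "t \<noteq> 0" for k
    using that assms by (simp add: pos_le_divide_eq)
  show "20/11 * y \<le> y / t"
  proof (cases "t = 0")
    case False
    \<comment> \<open>The two upper bounds on \<open>t\<close> average to 11/20.\<close>
    have "(20/11 * y) * t \<le> (20/11 * y) * (11/20)"
      using assms by (intro mult_left_mono) auto
    then show ?thesis using False by (intro le_div) auto
  qed (use assms in auto)
  show "2 * min y (2/15) \<le> y / t"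
  proof (cases "t = 0")
    case False
    have "2 * min y (2/15) * t \<le> y"
    \<comment> \<open>The threshold 2/15 is where 11/30 + y reaches 1/2. Beyond it y / (11/30 + y),
      which increases in y, is at least 4/15.\<close>
    proof (cases "y \<le> 2/15")
      case True
      have "2 * y * t \<le> 2 * y * (1/2)"
        using assms True by (intro mult_left_mono) auto
      then show ?thesis using True by (simp add: min_def)
    next
      case False
      have "4/15 * t \<le> y" using assms False by linarith
      then show ?thesis using False by (simp add: min_def)
    qed
    then show ?thesis using False by (rule le_div)
  qed (use assms in auto)
  show "2 * y - 1/30 \<le> y / t"
  proof (cases "t = 0")
    case False
    have "(2 * y - 1/30) * t \<le> y"
    proof (cases "y \<le> 1/60")
      case True
      then have "(2 * y - 1/30) * t \<le> 0"
        using assms by (intro mult_nonpos_nonneg) auto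
      then show ?thesis using assms by linarith
    next
      case y: False
      show ?thesis
      \<comment> \<open>At y = 11/60 the two upper bounds on \<open>t\<close> meet at 11/20, and
        with that \<open>t\<close> the claim is an equality; hence the factor 11/60 - y in both
        factorizations.\<close>
      proof (cases "y \<le> 11/60")
        case True
        have "(2 * y - 1/30) * t \<le> (2 * y - 1/30) * (11/30 + y)"
          using assms y by (intro mult_left_mono) auto
        moreover have "(11/60 - y) * (y + 1/30) \<ge> 0"
          using assms True by (intro mult_nonneg_nonneg) auto
        moreover have "(2 * y - 1/30) * (11/30 + y) = y - 2 * ((11/60 - y) * (y + 1/30))"
          by (simp add: field_simps)
        ultimately show ?thesis by linarith
      next
        case False
        have "(2 * y - 1/30) * t \<le> (2 * y - 1/30) * (22/30 - y)"
          using assms y by (intro mult_left_mono) auto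
        moreover have "(y - 11/60) * (y - 1/15) \<ge> 0"
          using assms False by (intro mult_nonneg_nonneg) auto
        moreover have "(2 * y - 1/30) * (22/30 - y) = y - 2 * ((y - 11/60) * (y - 1/15))"
          by (simp add: field_simps)
        ultimately show ?thesis by linarith
      qed
    qed
    then show ?thesis using False by (rule le_div)
  qed (use assms in auto)
qed

text \<open>Count the items worth at least 2/15. With none, the charge is at least 2 * 4/15. With
  one, the loss of 1/30 leaves exactly 8/15 - 1/30 = 1/2. With two, each contributes at least
  4/15.\<close>

lemma sum_charge_ge_half:
  fixes y c :: "'b \<Rightarrow> real"
  assumes "finite R" "\<And>x. x \<in> R \<Longrightarrow> 0 \<le> y x"
    and c1: "\<And>x. x \<in> R \<Longrightarrow> 2 * min (y x) (2/15) \<le> c x"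
    and c2: "\<And>x. x \<in> R \<Longrightarrow> 2 * y x - 1/30 \<le> c x"
    and "sum y R \<ge> 4/15"
  shows "sum c R \<ge> 1/2"
proof -
  have cnn: "0 \<le> c x" if "x \<in> R" for x
    using c1[OF that] assms(2)[OF that] by linarith
  have small: "sum c R' \<ge> 2 * sum y R'" if "R' \<subseteq> R" "\<And>x. x \<in> R' \<Longrightarrow> y x < 2/15" for R'
    unfolding sum_distrib_left
  proof (rule sum_mono)
    fix x assume "x \<in> R'"
    then show "2 * y x \<le> c x" using c1[of x] that(1) that(2)[of x] by auto
  qed
  show ?thesis
  proof (cases "\<exists>x\<in>R. y x \<ge> 2/15")
    case False
    then have "sum c R \<ge> 2 * sum y R" by (intro small) auto
    then show ?thesis using assms(5) by linarith
  next
    case True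
    then obtain x where x: "x \<in> R" "y x \<ge> 2/15" by blast
    have sc: "sum c R = c x + sum c (R - {x})" and sy: "sum y R = y x + sum y (R - {x})"
      using x assms(1) by (simp_all add: sum.remove)
    show ?thesis
    proof (cases "\<exists>z\<in>R - {x}. y z \<ge> 2/15")
      case False
      then have "sum c (R - {x}) \<ge> 2 * sum y (R - {x})" by (intro small) (auto simp: not_le)
      then show ?thesis using c2[OF x(1)] sc sy assms(5) by linarith
    next
      case True
      then obtain z where z: "z \<in> R - {x}" "y z \<ge> 2/15" by blast
      have "c z \<le> sum c (R - {x})"
        using z assms(1) cnn by (intro member_le_sum) auto
      then show ?thesis using c1[of x] c1[of z] x z sc by auto
    qed
  qed
qed

text \<open>Removing any item leaves less than \<alpha>. For two items a, b other than x, adding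
  these bounds gives 2 w(S) < 2 \<alpha> + w(a) + w(b) \<le> 2 \<alpha> + w(S) - w(x); this is where
  size three enters.\<close>

lemma minimal_bundle_total:
  fixes w :: "'b \<Rightarrow> real"
  assumes "finite S" "card S \<ge> 3" "x \<in> S" "\<And>z. z \<in> S \<Longrightarrow> 0 \<le> w z"
    and proper: "\<And>S'. S' \<subset> S \<Longrightarrow> sum w S' < \<alpha>"
  shows "w x \<le> sum w S" "sum w S \<le> \<alpha> + w x" "sum w S \<le> 2 * \<alpha> - w x"
proof -
  show "w x \<le> sum w S" using assms by (intro member_le_sum) auto
  have rem: "sum w S < \<alpha> + w z" if "z \<in> S" for z
    using proper[of "S - {z}"] that assms(1) by (auto simp: sum.remove)
  then show "sum w S \<le> \<alpha> + w x" using assms(3) by force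
  have "card (S - {x}) \<ge> 2" using assms by (simp add: card_Diff_singleton)
  then obtain C where "C \<subseteq> S - {x}" "card C = 2"
    by (rule obtain_subset_with_card_n)
  then obtain a b where ab: "a \<in> S - {x}" "b \<in> S - {x}" "a \<noteq> b"
    by (auto simp: card_2_iff)
  have "sum w {a, b, x} \<le> sum w S"
    using ab assms by (intro sum_mono2) auto
  then have "w a + w b + w x \<le> sum w S" using ab by auto
  then show "sum w S \<le> 2 * \<alpha> - w x"
    using rem[of a] rem[of b] ab by auto
qed

section \<open>Double counting of charges over bundles and over parts\<close>

text \<open>The procedure is abstracted away: \<open>B\<close> stands for the served agents,
  \<open>S\<close> for their bundles, \<open>w\<close> for the values of an unserved agent, and
  \<open>T k\<close> for a feasible set attaining the normalized value 1 of its part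
  \<open>k\<close>.\<close>

lemma few_bundles_leave_valuable_part:
  fixes w :: "'b \<Rightarrow> real" and S :: "'a \<Rightarrow> 'b set" and T :: "nat \<Rightarrow> 'b set"
  assumes "finite B" "\<And>a. a \<in> B \<Longrightarrow> finite (S a)" "disjoint_family_on S B"
    and wS: "\<And>a x. a \<in> B \<Longrightarrow> x \<in> S a \<Longrightarrow> 0 \<le> w x"
    and proper: "\<And>a S'. a \<in> B \<Longrightarrow> S' \<subset> S a \<Longrightarrow> sum w S' < 11/30"
    and "\<And>k. k < n \<Longrightarrow> finite (T k)" "disjoint_family_on T {..<n}"
    and T1: "\<And>k. k < n \<Longrightarrow> sum w (T k) = 1"
    and left: "\<And>k. k < n \<Longrightarrow> sum w (T k - (\<Union>a\<in>B. S a)) < 11/30"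
  shows "n \<le> card B"
proof -
  define D where "D = (\<Union>a\<in>B. S a)"
  have finD: "finite D" using assms(1,2) by (auto simp: D_def)
  define own where "own x = (SOME a. a \<in> B \<and> x \<in> S a)" for x
  have own: "own x = a" if "a \<in> B" "x \<in> S a" for a x
    unfolding own_def using that assms(3)
    by (intro some_equality) (auto simp: disjoint_family_on_def)
  have ownD: "own x \<in> B" "x \<in> S (own x)" if "x \<in> D" for x
    using that own by (auto simp: D_def)
  define c where "c x = (if card (S (own x)) \<le> 2 then 1 / card (S (own x))
                         else w x / sum w (S (own x)))" for x
  have wD: "0 \<le> w x" if "x \<in> D" for x using that wS by (auto simp: D_def)
  have cnn: "0 \<le> c x" if "x \<in> D" for x
    using ownD[OF that] wD[OF that] wS by (auto simp: c_def intro!: divide_nonneg_nonneg sum_nonneg)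
  have "sum c D = (\<Sum>a\<in>B. sum c (S a))"
    unfolding D_def using assms(1,2,3)
    by (intro sum.UNION_disjoint) (auto simp: disjoint_family_on_def)
  also have "\<dots> \<le> (\<Sum>a\<in>B. 1)"
  proof (rule sum_mono)
    fix a assume a: "a \<in> B"
    have "sum c (S a) = (\<Sum>x\<in>S a. if card (S a) \<le> 2 then 1 / card (S a) else w x / sum w (S a))"
      using own[OF a] by (intro sum.cong) (auto simp: c_def)
    \<comment> \<open>An empty bundle carries charge 0, and so does a large one of total 0, where
      division yields 0; hence no equality.\<close>
    also have "\<dots> \<le> 1"
    proof (cases "card (S a) \<le> 2")
      case False
      then show ?thesis by (simp add: sum_divide_distrib[symmetric])
    qed simp
    finally show "sum c (S a) \<le> 1" .
  qed
  finally have upper: "sum c D \<le> card B" by simp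
  have part: "1 \<le> sum c (T k \<inter> D)" if k: "k < n" for k
  proof -
    have fin: "finite (T k)" using assms(6) k by auto
    define R where "R = {x \<in> T k \<inter> D. card (S (own x)) \<ge> 3}"
    define U where "U = {x \<in> T k \<inter> D. card (S (own x)) = 2}"
    have card_pos: "card (S (own x)) \<ge> 1" if "x \<in> D" for x
      using ownD[OF that] assms(2) by (metis One_nat_def Suc_leI card_gt_0_iff empty_iff)
    have finRU: "finite R" "finite U" using fin by (auto simp: R_def U_def)
    show ?thesis
    proof (cases "\<exists>x\<in>T k \<inter> D. card (S (own x)) = 1")
      case True
      then obtain x where x: "x \<in> T k \<inter> D" "card (S (own x)) = 1" by blast
      have "c x \<le> sum c (T k \<inter> D)" using x fin cnn by (intro member_le_sum) auto
      then show ?thesis using x by (simp add: c_def)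
    next
      case False
      then have split: "T k \<inter> D = U \<union> R" "U \<inter> R = {}"
        using card_pos by (force simp: U_def R_def)+
      have sumc: "sum c (T k \<inter> D) = sum c U + sum c R"
        unfolding split(1) using finRU(2,1) split(2) by (rule sum.union_disjoint)
      have "sum w (T k) = sum w (T k \<inter> D) + sum w (T k - D)"
        using fin by (metis sum.Int_Diff)
      also have "sum w (T k \<inter> D) = sum w U + sum w R"
        unfolding split(1) using finRU(2,1) split(2) by (rule sum.union_disjoint)
      finally have lost: "sum w U + sum w R > 19/30"
        using T1[OF k] left[OF k] by (simp add: D_def)
      have "sum c U = (\<Sum>x\<in>U. 1/2)"
        by (intro sum.cong) (auto simp: U_def c_def)
      then have cU: "sum c U = card U / 2" by simp
      have R: "20/11 * w x \<le> c x" "2 * min (w x) (2/15) \<le> c x" "2 * w x - 1/30 \<le> c x"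
        if "x \<in> R" for x
      proof -
        have x: "x \<in> D" "card (S (own x)) \<ge> 3" using that by (auto simp: R_def)
        note o = ownD[OF x(1)]
        have cx: "c x = w x / sum w (S (own x))" using x by (simp add: c_def)
        note t = minimal_bundle_total[of "S (own x)" x w "11/30", OF assms(2)[OF o(1)] x(2) o(2)
            wS[OF o(1)] proper[OF o(1)]]
        show "20/11 * w x \<le> c x" "2 * min (w x) (2/15) \<le> c x" "2 * w x - 1/30 \<le> c x"
          unfolding cx using item_charge_bounds[of "w x" "sum w (S (own x))"] t wD[OF x(1)] by auto
      qed
      have wR: "0 \<le> w x" if "x \<in> R" for x using that wD by (auto simp: R_def)
      have cR: "0 \<le> sum c R" using cnn by (intro sum_nonneg) (auto simp: R_def)
      \<comment> \<open>More than 19/30 = 1 - 11/30 is lost. Without pair items this costs at least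
        20/11 * 19/30 > 1; two pair items already pay 1. With one, worth less than 11/30, the larger
        bundles took at least 8/30 = 4/15.\<close>
      consider "card U = 0" | "card U = 1" | "card U \<ge> 2" by linarith
      then show ?thesis
      proof cases
        case 1
        then have "sum w U = 0" using finRU by simp
        moreover have "20/11 * sum w R \<le> sum c R"
          unfolding sum_distrib_left by (intro sum_mono R)
        ultimately show ?thesis using lost sumc cU by simp
      next
        case 2
        then obtain x where U: "U = {x}" by (auto simp: card_1_singleton_iff)
        then have x: "x \<in> D" "card (S (own x)) = 2" by (auto simp: U_def)
        \<comment> \<open>A single item of a pair is a proper subset of it, so it is worth less than
          11/30.\<close>
        have "{x} \<noteq> S (own x)"
        proof
          assume "{x} = S (own x)"
          then have "card (S (own x)) = card {x}" by (rule arg_cong[OF sym])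
          then show False using x(2) by simp
        qed
        then have "{x} \<subset> S (own x)" using ownD(2)[OF x(1)] by blast
        then have "w x < 11/30" using proper[OF ownD(1)[OF x(1)], of "{x}"] by simp
        then have "sum w R \<ge> 4/15" using lost U by simp
        then have "sum c R \<ge> 1/2"
          using finRU(1) wR R by (intro sum_charge_ge_half[of R w c]) auto
        then show ?thesis using sumc cU 2 by simp
      next
        case 3
        then show ?thesis using sumc cU cR by simp
      qed
    qed
  qed
  have "real n = (\<Sum>k<n. 1)" by simp
  also have "\<dots> \<le> (\<Sum>k<n. sum c (T k \<inter> D))" by (intro sum_mono part) auto
  also have "\<dots> = sum c (\<Union>k<n. T k \<inter> D)"
    using assms(6,7) by (intro sum.UNION_disjoint[symmetric]) (auto simp: disjoint_family_on_def)
  also have "\<dots> \<le> sum c D"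
    using finD cnn by (intro sum_mono2) auto
  also note upper
  finally show ?thesis by simp
qed

section \<open>Hereditary valuations and normalization\<close>

lemma hereditary_systemD:
  assumes "hereditary_system J F"
  shows "finite J" "finite F" "{} \<in> F" "S \<in> F \<Longrightarrow> S \<subseteq> J" "S \<in> F \<Longrightarrow> T \<subseteq> S \<Longrightarrow> T \<in> F"
proof -
  show J: "finite J" and "S \<in> F \<Longrightarrow> S \<subseteq> J" and sub: "S \<in> F \<Longrightarrow> T \<subseteq> S \<Longrightarrow> T \<in> F" for S T
    using assms by (auto simp: hereditary_system_def)
  show "finite F"
    using J assms by (meson finite_Pow_iff finite_subset hereditary_system_def)
  show "{} \<in> F" using sub assms by (auto simp: hereditary_system_def)
qed

lemma bundle_value_upper:
  assumes "hereditary_system J F" "T \<in> F" "T \<subseteq> S"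
  shows "sum u T \<le> bundle_value F u S"
  unfolding bundle_value_def using assms hereditary_systemD(2)[OF assms(1)] by (intro Max_ge) auto

lemma bundle_value_attained:
  assumes "hereditary_system J F"
  obtains T where "T \<in> F" "T \<subseteq> S" "bundle_value F u S = sum u T"
proof -
  have "Max {\<Sum>j\<in>T. u j |T. T \<in> F \<and> T \<subseteq> S} \<in> {\<Sum>j\<in>T. u j |T. T \<in> F \<and> T \<subseteq> S}"
    using hereditary_systemD(2,3)[OF assms] by (intro Max_in) auto
  then show ?thesis using that by (auto simp: bundle_value_def)
qed

context
  fixes n :: nat and J :: "'b set" and F :: "'b set set" and u :: "'b \<Rightarrow> real"
    and Q :: "nat \<Rightarrow> 'b set"
  assumes hereditary: "hereditary_system J F"
    and nonneg: "\<forall>j\<in>J. 0 \<le> u j"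
    and MMS_pos: "MMS n J F u > 0"
    and maximin: "maximin_partition n J F u Q"
begin

lemma MMS_le_part:
  assumes "k < n"
  shows "MMS n J F u \<le> bundle_value F u (Q k)"
proof -
  have "MMS n J F u = Min ((\<lambda>k. bundle_value F u (Q k)) ` {..<n})"
    using maximin by (simp add: maximin_partition_def min_part_value_def)
  also have "\<dots> \<le> bundle_value F u (Q k)" using assms by (intro Min_le) auto
  finally show ?thesis .
qed

lemma normalized_part:
  assumes "k < n" "j \<in> Q k"
  shows "normalized n F u Q j = u j / bundle_value F u (Q k)"
proof -
  have "(THE k. k < n \<and> j \<in> Q k) = k"
    using assms maximin
    by (intro the_equality) (auto simp: maximin_partition_def is_partition_def disjoint_family_on_def)
  then show ?thesis by (simp add: normalized_def)
qed

text \<open>Every part is worth at least the maximin share, so normalization divides by at least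
  that much.\<close>

lemma normalized_bounds:
  assumes "j \<in> J"
  shows "0 \<le> normalized n F u Q j" "normalized n F u Q j \<le> u j / MMS n J F u"
proof -
  obtain k where k: "k < n" "j \<in> Q k"
    using assms maximin by (auto simp: maximin_partition_def is_partition_def)
  show "0 \<le> normalized n F u Q j" "normalized n F u Q j \<le> u j / MMS n J F u"
    unfolding normalized_part[OF k]
    using MMS_le_part[OF k(1)] MMS_pos bspec[OF nonneg assms] by (auto intro: divide_left_mono)
qed

text \<open>Transfers the guarantee back: a bundle of normalized value \<alpha> is truly worth at
  least \<alpha> times the maximin share.\<close>

lemma bundle_value_normalized:
  "MMS n J F u * bundle_value F (normalized n F u Q) S \<le> bundle_value F u S"
proof -
  obtain T where T: "T \<in> F" "T \<subseteq> S"
    "bundle_value F (normalized n F u Q) S = sum (normalized n F u Q) T"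
    using bundle_value_attained[OF hereditary] .
  have "sum (normalized n F u Q) T \<le> (\<Sum>j\<in>T. u j / MMS n J F u)"
    using T(1) hereditary_systemD(4)[OF hereditary] by (intro sum_mono normalized_bounds) auto
  also have "\<dots> = sum u T / MMS n J F u" by (simp add: sum_divide_distrib)
  also have "\<dots> \<le> bundle_value F u S / MMS n J F u"
    using bundle_value_upper[OF hereditary T(1,2)] MMS_pos by (intro divide_right_mono) auto
  finally show ?thesis using MMS_pos T(3) by (simp add: field_simps)
qed

text \<open>All items of one part share the same positive divisor, the part's value, so a feasible
  set attaining that value is rescaled to total 1.\<close>

lemma normalized_part_witness:
  assumes "k < n"
  obtains T where "T \<in> F" "T \<subseteq> Q k" "sum (normalized n F u Q) T = 1"
proof -
  obtain T where T: "T \<in> F" "T \<subseteq> Q k" "bundle_value F u (Q k) = sum u T"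
    using bundle_value_attained[OF hereditary] .
  have "sum (normalized n F u Q) T = (\<Sum>j\<in>T. u j / bundle_value F u (Q k))"
    using T(2) by (intro sum.cong normalized_part[OF assms]) auto
  also have "\<dots> = 1"
    using T(3) MMS_le_part[OF assms] MMS_pos by (simp add: sum_divide_distrib[symmetric])
  finally show ?thesis using that T by blast
qed

end

section \<open>Invariant of the procedure\<close>

text \<open>The clause on \<open>card S < \<tau>\<close> says that smaller sizes are exhausted among
  the present items. The last clause keeps the consequence for bundles whose items have since left:
  they are minimal in the eyes of every agent still waiting.\<close>

definition fdp_invar ::
  "real \<Rightarrow> 'a set \<Rightarrow> 'b set \<Rightarrow> 'b set set \<Rightarrow> ('a \<Rightarrow> 'b \<Rightarrow> real) \<Rightarrow> ('a, 'b) fdp_state \<Rightarrow> bool" where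
  "fdp_invar \<alpha> I J F w = (\<lambda>(\<tau>, I', J', A).
     I' \<subseteq> I \<and> dom A = I - I' \<and> J' = J - \<Union>(ran A) \<and> disjoint_family_on (the \<circ> A) (dom A) \<and>
     (\<forall>b\<in>I'. \<forall>S\<subseteq>J'. card S < \<tau> \<longrightarrow> bundle_value F (w b) S < \<alpha>) \<and>
     (\<forall>a\<in>dom A. bundle_value F (w a) (the (A a)) \<ge> \<alpha> \<and> the (A a) \<in> F \<and>
        (\<forall>b\<in>I'. \<forall>S'\<subset>the (A a). bundle_value F (w b) S' < \<alpha>)))"

lemma fdp_invarD:
  assumes "fdp_invar \<alpha> I J F w (\<tau>, I', J', A)"
  shows "I' \<subseteq> I" "dom A = I - I'" "J' = J - \<Union>(ran A)"
    and "disjoint_family_on (the \<circ> A) (dom A)"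
    and "\<forall>b\<in>I'. \<forall>S\<subseteq>J'. card S < \<tau> \<longrightarrow> bundle_value F (w b) S < \<alpha>"
    and "\<forall>a\<in>dom A. bundle_value F (w a) (the (A a)) \<ge> \<alpha> \<and> the (A a) \<in> F \<and>
        (\<forall>b\<in>I'. \<forall>S'\<subset>the (A a). bundle_value F (w b) S' < \<alpha>)"
  using assms unfolding fdp_invar_def prod.case by - (elim conjE, assumption)+

text \<open>The value is attained by a feasible subset, which would itself be worth \<alpha> if it
  were proper.\<close>

lemma minimal_bundle_feasible:
  assumes H: "hereditary_system J F" and "bundle_value F u S \<ge> \<alpha>"
    and "\<And>S'. S' \<subset> S \<Longrightarrow> bundle_value F u S' < \<alpha>"
  shows "S \<in> F"
proof -
  obtain T where T: "T \<in> F" "T \<subseteq> S" "bundle_value F u S = sum u T"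
    using bundle_value_attained[OF H] .
  have "sum u T \<le> bundle_value F u T" using bundle_value_upper[OF H T(1)] by blast
  then have "\<not> T \<subset> S" using assms(2) assms(3)[of T] T(3) by linarith
  then show ?thesis using T by auto
qed

lemma fdp_invar_step:
  assumes H: "hereditary_system J F" and inv: "fdp_invar \<alpha> I J F w s"
    and step: "fdp_step \<alpha> F w m s s'"
  shows "fdp_invar \<alpha> I J F w s'"
  using step
proof cases
  case (allocate \<tau> I' J' S i A)
  note inv' = fdp_invarD[OF inv[unfolded allocate(1)]]
  have S: "S \<subseteq> J'" "card S = \<tau>" "i \<in> I'" "bundle_value F (w i) S \<ge> \<alpha>"
    using allocate by (auto simp: valid_pair_def)
  have finS: "finite S"
    using S(1) inv'(3) hereditary_systemD(1)[OF H] by (auto intro: finite_subset)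
  \<comment> \<open>A proper subset has fewer than \<tau> items, a size already exhausted. For
    \<open>i\<close> this makes \<open>S\<close> feasible; for the agents left it gives the
    minimality clause.\<close>
  have small: "bundle_value F (w b) S' < \<alpha>" if "b \<in> I'" "S' \<subset> S" for b S'
    using that inv'(5) S psubset_card_mono[OF finS that(2)] by auto
  have SF: "S \<in> F" using H S(4) small[OF S(3)] by (rule minimal_bundle_feasible)
  have Anone: "A i = None" using S(3) inv'(2) by blast
  have disj: "S \<inter> \<Union>(ran A) = {}" using S(1) inv'(3) by blast
  show ?thesis
    unfolding allocate(2) fdp_invar_def prod.case
  proof (intro conjI ballI)
    show "I' - {i} \<subseteq> I" "dom (A(i \<mapsto> S)) = I - (I' - {i})"
      using inv'(1,2) S(3) by auto
    show "J' - S = J - \<Union>(ran (A(i \<mapsto> S)))"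
      using inv'(3) Anone by (auto simp: ran_map_upd)
    have "the (A a) \<inter> S = {}" if "a \<in> dom A" for a
      using that disj by (fastforce simp: ran_def)
    then show "disjoint_family_on (the \<circ> A(i \<mapsto> S)) (dom (A(i \<mapsto> S)))"
      using inv'(4) Anone by (auto simp: disjoint_family_on_def domIff)
  next
    fix b assume "b \<in> I' - {i}"
    then show "\<forall>S''\<subseteq>J' - S. card S'' < \<tau> \<longrightarrow> bundle_value F (w b) S'' < \<alpha>"
      using inv'(5) by blast
  next
    fix a assume "a \<in> dom (A(i \<mapsto> S))"
    then show "\<alpha> \<le> bundle_value F (w a) (the ((A(i \<mapsto> S)) a))" "the ((A(i \<mapsto> S)) a) \<in> F"
      using inv'(6) S(4) SF by (cases "a = i"; auto)+
    fix b assume "b \<in> I' - {i}"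
    then show "\<forall>S'\<subset>the ((A(i \<mapsto> S)) a). bundle_value F (w b) S' < \<alpha>"
      using inv'(6) small[of b] \<open>a \<in> dom (A(i \<mapsto> S))\<close> by (cases "a = i") auto
  qed
next
  case (advance \<tau> I' J' A)
  note inv' = fdp_invarD[OF inv[unfolded advance(1)]]
  have "bundle_value F (w b) S < \<alpha>" if "b \<in> I'" "S \<subseteq> J'" "card S < Suc \<tau>" for b S
  proof (cases "card S = \<tau>")
    case True
    then have "\<not> bundle_value F (w b) S \<ge> \<alpha>"
      using advance(4) that by (auto simp: valid_pair_def)
    then show ?thesis by simp
  next
    case False
    then show ?thesis using inv'(5) that by auto
  qed
  then show ?thesis
    unfolding advance(2) fdp_invar_def prod.case using inv' by blast
qed

lemma fdp_invar_reachable: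
  assumes H: "hereditary_system J F" and "\<alpha> > 0"
    and "(fdp_step \<alpha> F w m)\<^sup>*\<^sup>* (1, I, J, Map.empty) s"
  shows "fdp_invar \<alpha> I J F w s"
  using assms(3)
proof induction
  case base
  \<comment> \<open>As \<open>J\<close> is finite, only the empty set has size below the initial
    \<tau> = 1, and its value 0 is below the positive target.\<close>
  have "bundle_value F (w b) S < \<alpha>" if "S \<subseteq> J" "card S < 1" for b S
  proof -
    have "S = {}" using that hereditary_systemD(1)[OF H] finite_subset by fastforce
    moreover obtain T where "T \<subseteq> S" "bundle_value F (w b) S = sum (w b) T"
      using bundle_value_attained[OF H] .
    ultimately show ?thesis using assms(2) by simp
  qed
  then show ?case by (simp add: fdp_invar_def disjoint_family_on_def)
next
  case (step s s')
  then show ?case using fdp_invar_step[OF H] by blast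
qed

section \<open>No agent stays unserved, and bundles keep their worth in the original values\<close>

theorem theorem3:
  fixes I :: "'a set" and J :: "'b set" and F :: "'b set set" and n :: nat
    and v :: "'a \<Rightarrow> 'b \<Rightarrow> real" and P :: "'a \<Rightarrow> nat \<Rightarrow> 'b set"
    and A :: "'a \<Rightarrow> 'b set option"
  assumes "hereditary_system J F"
    and "finite I" and "card I = n" and "n \<ge> 1"
    and "\<And>i j. i \<in> I \<Longrightarrow> j \<in> J \<Longrightarrow> v i j \<ge> 0"
    and "\<And>i. i \<in> I \<Longrightarrow> MMS n J F (v i) > 0"
    and "\<And>i. i \<in> I \<Longrightarrow> maximin_partition n J F (v i) (P i)"
    and "fdp_result (11/30) I J F v P A"
  shows "\<forall>i\<in>I. \<exists>S. A i = Some S \<and> bundle_value F (v i) S \<ge> 11/30 * MMS n J F (v i)"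
proof -
  note H = assms(1)
  define w where "w i = normalized n F (v i) (P i)" for i
  obtain I' J' where "(fdp_step (11/30) F w (card J))\<^sup>*\<^sup>* (1, I, J, Map.empty) (Suc (card J), I', J', A)"
    using assms(8) unfolding fdp_result_def assms(3) w_def by blast
  then have "fdp_invar (11/30) I J F w (Suc (card J), I', J', A)"
    by (intro fdp_invar_reachable[OF H]) auto
  note inv = fdp_invarD[OF this]
  have "I' = {}"
  proof (rule ccontr)
    assume "I' \<noteq> {}"
    then obtain i where i: "i \<in> I'" by blast
    then have iI: "i \<in> I" using inv(1) by blast
    have v_nonneg: "\<forall>j\<in>J. 0 \<le> v i j" using assms(5)[OF iI] by blast
    note agent = H v_nonneg assms(6)[OF iI] assms(7)[OF iI]
    have "\<exists>T. T \<in> F \<and> T \<subseteq> P i k \<and> sum (w i) T = 1" if "k < n" for k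
      using normalized_part_witness[OF agent that] unfolding w_def by blast
    then obtain T where T: "\<And>k. k < n \<Longrightarrow> T k \<in> F \<and> T k \<subseteq> P i k \<and> sum (w i) (T k) = 1"
      by metis
    have finF: "finite S" if "S \<in> F" for S
      using that hereditary_systemD(1,4)[OF H] by (meson finite_subset)
    have w_nonneg: "0 \<le> w i j" if "j \<in> J" for j
      unfolding w_def using normalized_bounds(1)[OF agent that] .
    \<comment> \<open>For feasible sets the bounds on \<open>bundle_value\<close> turn into bounds
      on plain sums, the form needed for counting.\<close>
    have w_sum: "sum (w i) S < 11/30" if "bundle_value F (w i) S < 11/30" "S \<in> F" for S
      using bundle_value_upper[OF H that(2) subset_refl, of "w i"] that(1) by linarith
    have ranA: "(\<Union>a\<in>dom A. (the \<circ> A) a) = \<Union>(ran A)"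
      by (force simp: ran_def dom_def)
    have "n \<le> card (dom A)"
    proof (rule few_bundles_leave_valuable_part[where S = "the \<circ> A" and T = T and w = "w i"])
      show "finite (dom A)" using inv(2) assms(2) by simp
      show "disjoint_family_on (the \<circ> A) (dom A)" by (fact inv(4))
      show "disjoint_family_on T {..<n}"
        unfolding disjoint_family_on_def
      proof (intro ballI impI)
        fix k l assume kl: "k \<in> {..<n}" "l \<in> {..<n}" "k \<noteq> l"
        have "disjoint_family_on (P i) {..<n}"
          using assms(7)[OF iI] by (simp add: maximin_partition_def is_partition_def)
        then have "P i k \<inter> P i l = {}" using kl by (rule disjoint_family_onD)
        moreover have "T k \<subseteq> P i k" "T l \<subseteq> P i l" using T kl by auto
        ultimately show "T k \<inter> T l = {}" by blast
      qed
    next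
      fix a assume "a \<in> dom A"
      note a = bspec[OF inv(6) this]
      then show "finite ((the \<circ> A) a)" using finF by auto
      show "0 \<le> w i x" if "x \<in> (the \<circ> A) a" for x
        using that a hereditary_systemD(4)[OF H] w_nonneg by auto
      show "sum (w i) S' < 11/30" if "S' \<subset> (the \<circ> A) a" for S'
        using that a i hereditary_systemD(5)[OF H] by (intro w_sum) auto
    next
      fix k assume k: "k < n"
      show "finite (T k)" "sum (w i) (T k) = 1" using T[OF k] finF by auto
      \<comment> \<open>The remainder of \<open>T k\<close> is still unallocated, and the final
        \<tau> = \<open>Suc (card J)\<close> exceeds every possible size, so the invariant bounds
        its value.\<close>
      let ?R = "T k - (\<Union>a\<in>dom A. (the \<circ> A) a)"
      have R: "?R \<in> F" using T[OF k] hereditary_systemD(5)[OF H] by blast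
      have "?R \<subseteq> J'" using hereditary_systemD(4)[OF H R] unfolding ranA inv(3) by blast
      moreover have "card ?R < Suc (card J)"
        using card_mono[OF hereditary_systemD(1)[OF H] hereditary_systemD(4)[OF H R]] by simp
      ultimately show "sum (w i) ?R < 11/30" using inv(5) i R by (intro w_sum) auto
    qed
    \<comment> \<open>The unserved agent \<open>i\<close> is missing from \<open>dom A\<close>, so
      fewer than n bundles were allocated.\<close>
    moreover have "card (dom A) < card I"
      using inv(2) i iI assms(2) by (intro psubset_card_mono) auto
    ultimately show False using assms(3) by simp
  qed
  show ?thesis
  proof
    fix i assume i: "i \<in> I"
    then have "i \<in> dom A" using inv(2) \<open>I' = {}\<close> by simp
    then obtain S where S: "A i = Some S" by blast
    have "11/30 * MMS n J F (v i) \<le> MMS n J F (v i) * bundle_value F (w i) S"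
      using bspec[OF inv(6) \<open>i \<in> dom A\<close>] S assms(6)[OF i] by simp
    also have "\<dots> \<le> bundle_value F (v i) S"
      unfolding w_def
      using bundle_value_normalized[OF H _ assms(6)[OF i] assms(7)[OF i]] assms(5)[OF i] by blast
    finally show "\<exists>S. A i = Some S \<and> bundle_value F (v i) S \<ge> 11/30 * MMS n J F (v i)"
      using S by blast
  qed
qed

end
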